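(* Let $n\ge1$ and $M\ge2$ be integers, let $X_1,\dots,X_n\in\mathcal X$ be fixed points, and let $Y_i=f(X_i)+W_i$, $i=1,\dots,n$, where $W_1,\dots,W_n$ are independent $N(0,\sigma^2)$ random variables and $f,f_1,\dots,f_M:\mathcal X\to\mathbb R$ are functions bounded in absolute value by a constant $L<\infty$ on $\mathcal X$. Let $\Psi_n=\left(\frac1n\sum_{i=1}^nf_j(X_i)f_{j'}(X_i)\right)_{1\le j,j'\le M}$ and $\mathrm{diag}(\Psi_n)=\mathrm{diag}(\|f_1\|_n^2,\dots,\|f_M\|_n^2)$, and assume that $\kappa=\kappa_{n,M}>0$ is such that the matrix $\Psi_n-\kappa\,\mathrm{diag}(\Psi_n)$ is positive semidefinite. Let $\widehat\lambda$ be any minimizer over $\lambda\in\mathbb R^M$ of $\frac1n\sum_{i=1}^n\{Y_i-\mathsf f_\lambda(X_i)\}^2+\mathrm{pen}(\lambda)$, where $$\mathrm{pen}(\lambda)=2\sqrt2\,\sigma\sqrt{\frac{\log M+\log n}{n}}\sum_{j=1}^M|\lambda_j|\,\|f_j\|_n,$$ and let $\widetilde f=\mathsf f_{\widehat\lambda}$. Then, for all $\varepsilon>0$, $$\mathbb E_f\|\widetilde f-f\|_n^2\le\inf_{\lambda\in\mathbb R^M}\left\{(1+\varepsilon)\|\mathsf f_\lambda-f\|_n^2+8\left(4+\varepsilon+\frac4\varepsilon\right)\frac{\sigma^2}{\kappa}\,\frac{\log M+\log n}{n}\,M(\lambda)\right\}$$ $$+\frac{4L^2+12\sigma^2}{n\sqrt{\pi(\log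 M+\log n)}}+6\sigma^2\sqrt{\frac{n+2}{n}}\exp\left(-\frac n{16}\right).$$
   Context: $\mathcal X$ is a Borel subset of $\mathbb R^d$. For a function $g:\mathcal X\to\mathbb R$, $\|g\|_n=\{n^{-1}\sum_{i=1}^n g^2(X_i)\}^{1/2}$. For $\lambda=(\lambda_1,\dots,\lambda_M)\in\mathbb R^M$: $\mathsf f_\lambda=\sum_{j=1}^M\lambda_jf_j$, and $M(\lambda)$ is the number of nonzero coordinates of $\lambda$. $\mathbb E_f$ denotes expectation under the model with regression function $f$. $\widehat\lambda$ is a (measurable) function of the data; it need not be unique and the result is for any such minimizer. *)

theory Defs
  imports "HOL-Probability.Probability"
begin

text \<open>
  Conventions: the sample size is \<open>CARD('n)\<close>, the dictionary size is \<open>CARD('m)\<close>, and the design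
  points live in \<open>real ^ 'd\<close>. The functions on the design space are total HOL functions, of
  which only the values on that space are ever used.
\<close>

definition emp_norm :: "('n::finite \<Rightarrow> 'x) \<Rightarrow> ('x \<Rightarrow> real) \<Rightarrow> real" where
  "emp_norm X g = sqrt ((1 / real CARD('n)) * (\<Sum>i\<in>UNIV. (g (X i))\<^sup>2))"

definition lin_comb :: "('m::finite \<Rightarrow> 'x \<Rightarrow> real) \<Rightarrow> real ^ 'm \<Rightarrow> 'x \<Rightarrow> real" where
  "lin_comb F lam x = (\<Sum>j\<in>UNIV. lam $ j * F j x)"

definition num_nonzero :: "real ^ 'm::finite \<Rightarrow> nat" where
  "num_nonzero lam = card {j. lam $ j \<noteq> 0}"

definition gram :: "('n::finite \<Rightarrow> 'x) \<Rightarrow> ('m::finite \<Rightarrow> 'x \<Rightarrow> real) \<Rightarrow> real ^ 'm ^ 'm" where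
  "gram X F = (\<chi> j j'. (1 / real CARD('n)) * (\<Sum>i\<in>UNIV. F j (X i) * F j' (X i)))"

definition diag_gram :: "('n::finite \<Rightarrow> 'x) \<Rightarrow> ('m::finite \<Rightarrow> 'x \<Rightarrow> real) \<Rightarrow> real ^ 'm ^ 'm" where
  "diag_gram X F = (\<chi> j j'. if j = j' then (emp_norm X (F j))\<^sup>2 else 0)"

definition pos_semidef :: "real ^ 'm ^ 'm::finite \<Rightarrow> bool" where
  "pos_semidef A \<longleftrightarrow> transpose A = A \<and> (\<forall>v. 0 \<le> v \<bullet> (A *v v))"

text \<open>
  The normal law with standard deviation \<open>\<sigma> \<ge> 0\<close>. The case \<open>\<sigma> = 0\<close> (point mass) is separate
  because \<open>normal_density \<mu> 0\<close> is identically zero.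
\<close>

definition normal_law :: "real \<Rightarrow> real \<Rightarrow> real measure" where
  "normal_law \<mu> \<sigma> =
     (if \<sigma> = 0 then return borel \<mu> else density lborel (\<lambda>x. ennreal (normal_density \<mu> \<sigma> x)))"

definition pen :: "real \<Rightarrow> ('n::finite \<Rightarrow> 'x) \<Rightarrow> ('m::finite \<Rightarrow> 'x \<Rightarrow> real) \<Rightarrow> real ^ 'm \<Rightarrow> real" where
  "pen \<sigma> X F lam =
     2 * sqrt 2 * \<sigma> * sqrt ((ln (real CARD('m)) + ln (real CARD('n))) / real CARD('n)) *
       (\<Sum>j\<in>UNIV. \<bar>lam $ j\<bar> * emp_norm X (F j))"

definition criterion ::
  "real \<Rightarrow> ('n::finite \<Rightarrow> 'x) \<Rightarrow> ('m::finite \<Rightarrow> 'x \<Rightarrow> real) \<Rightarrow> real ^ 'n \<Rightarrow> real ^ 'm \<Rightarrow> real" where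
  "criterion \<sigma> X F y lam =
     (1 / real CARD('n)) * (\<Sum>i\<in>UNIV. (y $ i - lin_comb F lam (X i))\<^sup>2) + pen \<sigma> X F lam"

definition response ::
  "('n::finite \<Rightarrow> 'x) \<Rightarrow> ('x \<Rightarrow> real) \<Rightarrow> ('n \<Rightarrow> 'w \<Rightarrow> real) \<Rightarrow> 'w \<Rightarrow> real ^ 'n" where
  "response X f W \<omega> = (\<chi> i. f (X i) + W i \<omega>)"

end

theory Submission
  imports Defs "HOL-Real_Asymp.Real_Asymp"
begin

text \<open>
  Let \<open>u\<close>, \<open>v\<close> be the empirical distances of the estimator and of a competitor \<open>\<lambda>\<close> to \<open>f\<close>, and
  let \<open>t\<close> be the penalty level. If every noise correlation satisfies
  \<open>2 \<bar>n\<^sup>-\<^sup>1 \<Sum>\<^sub>i f\<^sub>j(X\<^sub>i) W\<^sub>i\<bar> \<le> t \<parallel>f\<^sub>j\<parallel>\<^sub>n\<close>, comparing the criterion at the two parameters makes the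
  penalties absorb the noise outside the support of \<open>\<lambda>\<close>; Cauchy-Schwarz on the support and the
  hypothesis on the Gram matrix leave \<open>u\<^sup>2 \<le> v\<^sup>2 + 2 b (u + v)\<close> with \<open>b\<^sup>2 = t\<^sup>2 M(\<lambda>) / \<kappa>\<close>, that is
  \<open>u \<le> v + 2 b\<close>. By the Gaussian tail bound and a union bound the exceptional event has probability
  at most \<open>1 / (n sqrt (\<pi> (log M + log n)))\<close>. On it, comparison with the zero parameter gives
  \<open>u\<^sup>2 \<le> 4 L\<^sup>2 + 6 \<parallel>W\<parallel>\<^sub>n\<^sup>2\<close>, and the part of \<open>\<parallel>W\<parallel>\<^sub>n\<^sup>2\<close> exceeding \<open>2 \<sigma>\<^sup>2\<close> is dominated by
  \<open>\<parallel>W\<parallel>\<^sub>n\<^sup>2 exp (n \<parallel>W\<parallel>\<^sub>n\<^sup>2 / (8 \<sigma>\<^sup>2) - n / 4)\<close>, whose expectation is explicit.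
\<close>

section \<open>Empirical norm and quadratic forms of the Gram matrix\<close>

lemma emp_norm_sq:
  "(emp_norm X g)\<^sup>2 = (1 / real CARD('n)) * (\<Sum>i\<in>UNIV. (g (X i))\<^sup>2)" for X :: "'n::finite \<Rightarrow> 'x"
  unfolding emp_norm_def by (rule real_sqrt_pow2) (simp add: sum_nonneg)

lemma emp_norm_nonneg: "0 \<le> emp_norm X g"
  unfolding emp_norm_def by (simp add: sum_nonneg)

text \<open>As a multiple of the Euclidean norm of the vector of values at the design points,
  \<open>emp_norm\<close> inherits the triangle inequality.\<close>

lemma emp_norm_eq_norm:
  "emp_norm X g = norm (\<chi> i. g (X i)) / sqrt (real CARD('n))" for X :: "'n::finite \<Rightarrow> 'x"
  unfolding emp_norm_def norm_vec_def L2_set_def by (simp add: real_sqrt_divide)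

lemma emp_norm_triangle:
  "emp_norm X (\<lambda>x. g x - h x) \<le> emp_norm X (\<lambda>x. g x - k x) + emp_norm X (\<lambda>x. h x - k x)"
proof -
  have "norm (\<chi> i. g (X i) - h (X i)) \<le> norm (\<chi> i. g (X i) - k (X i)) + norm (\<chi> i. h (X i) - k (X i))"
    using norm_triangle_ineq4[of "\<chi> i. g (X i) - k (X i)" "\<chi> i. h (X i) - k (X i)"]
    by (simp add: minus_vec_def)
  thus ?thesis
    unfolding emp_norm_eq_norm by (simp add: add_divide_distrib[symmetric] divide_right_mono)
qed

lemma lin_comb_diff: "lin_comb F (a - b) x = lin_comb F a x - lin_comb F b x"
  by (simp add: lin_comb_def sum_subtractf left_diff_distrib)

lemma gram_quadratic_form:
  fixes X :: "'n::finite \<Rightarrow> 'x" and F :: "'m::finite \<Rightarrow> 'x \<Rightarrow> real"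
  shows "v \<bullet> (gram X F *v v) = (emp_norm X (lin_comb F v))\<^sup>2"
proof -
  have sq: "(lin_comb F v x)\<^sup>2 = (\<Sum>j\<in>UNIV. \<Sum>j'\<in>UNIV. (v$j * F j x) * (v$j' * F j' x))" for x
    by (simp add: lin_comb_def power2_eq_square sum_product)
  have "v \<bullet> (gram X F *v v)
      = (\<Sum>j\<in>UNIV. \<Sum>j'\<in>UNIV. \<Sum>i\<in>UNIV. (1 / real CARD('n)) * ((v$j * F j (X i)) * (v$j' * F j' (X i))))"
    by (simp add: inner_vec_def matrix_vector_mult_def gram_def sum_distrib_left sum_distrib_right sum_divide_distrib mult_ac)
  also have "\<dots> = (\<Sum>j\<in>UNIV. \<Sum>i\<in>UNIV. \<Sum>j'\<in>UNIV. (1 / real CARD('n)) * ((v$j * F j (X i)) * (v$j' * F j' (X i))))"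
    by (intro sum.cong refl sum.swap)
  also have "\<dots> = (\<Sum>i\<in>UNIV. \<Sum>j\<in>UNIV. \<Sum>j'\<in>UNIV. (1 / real CARD('n)) * ((v$j * F j (X i)) * (v$j' * F j' (X i))))"
    by (rule sum.swap)
  also have "\<dots> = (1 / real CARD('n)) * (\<Sum>i\<in>UNIV. (lin_comb F v (X i))\<^sup>2)"
    by (simp add: sq sum_distrib_left)
  finally show ?thesis by (simp add: emp_norm_sq)
qed

lemma diag_gram_quadratic_form:
  "v \<bullet> (diag_gram X F *v v) = (\<Sum>j\<in>UNIV. (v$j * emp_norm X (F j))\<^sup>2)"
  by (simp add: inner_vec_def matrix_vector_mult_def diag_gram_def if_distrib if_distribR
      power2_eq_square mult_ac cong: if_cong)

text \<open>Testing the semidefinite matrix at \<open>v\<close> turns the Gram hypothesis into a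
  bound on the weighted coefficients by the prediction norm.\<close>

lemma diag_gram_bound:
  assumes "pos_semidef (gram X F - \<kappa> *\<^sub>R diag_gram X F)"
  shows "\<kappa> * (\<Sum>j\<in>UNIV. (v$j * emp_norm X (F j))\<^sup>2) \<le> (emp_norm X (lin_comb F v))\<^sup>2"
proof -
  have "0 \<le> v \<bullet> ((gram X F - \<kappa> *\<^sub>R diag_gram X F) *v v)"
    using assms unfolding pos_semidef_def by blast
  thus ?thesis
    by (simp add: matrix_vector_mult_diff_rdistrib scaleR_matrix_vector_assoc[symmetric]
        inner_diff_right gram_quadratic_form diag_gram_quadratic_form)
qed

section \<open>Deterministic inequalities for a fixed noise vector\<close>

lemma criterion_expand:
  fixes X :: "'n::finite \<Rightarrow> 'x" 
  shows "criterion \<sigma> X F (\<chi> i. f (X i) + w i) lam =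
    (emp_norm X (\<lambda>x. lin_comb F lam x - f x))\<^sup>2 + (1 / real CARD('n)) * (\<Sum>i\<in>UNIV. (w i)\<^sup>2)
     - (2 / real CARD('n)) * (\<Sum>i\<in>UNIV. w i * (lin_comb F lam (X i) - f (X i))) + pen \<sigma> X F lam"
proof -
  have "(\<Sum>i\<in>UNIV. (f (X i) + w i - lin_comb F lam (X i))\<^sup>2) = 
     (\<Sum>i\<in>UNIV. (lin_comb F lam (X i) - f (X i))\<^sup>2) + (\<Sum>i\<in>UNIV. (w i)\<^sup>2) 
       - 2 * (\<Sum>i\<in>UNIV. w i * (lin_comb F lam (X i) - f (X i)))"
    unfolding sum_distrib_left sum.distrib[symmetric] sum_subtractf[symmetric]
    by (intro sum.cong refl) (simp add: power2_eq_square algebra_simps)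
  thus ?thesis
    unfolding criterion_def emp_norm_sq
    by (simp only: vec_lambda_beta) (simp add: add_divide_distrib diff_divide_distrib)
qed

text \<open>Factoring \<open>u\<^sup>2 - v\<^sup>2 = (u - v) * (u + v)\<close> and cancelling
  \<open>u + v\<close> gives \<open>u \<le> v + 2 * b\<close>. After squaring, the cross term
  \<open>4 * v * b\<close> is split by Young's inequality into \<open>\<epsilon> * v\<^sup>2\<close>
  and \<open>4 / \<epsilon> * b\<^sup>2\<close>.\<close>

lemma quadratic_self_bound:
  fixes u v b \<epsilon> :: real
  assumes "0 \<le> u" "0 \<le> v" "0 \<le> b" "0 < \<epsilon>" "u\<^sup>2 \<le> v\<^sup>2 + 2 * b * (u + v)"
  shows "u\<^sup>2 \<le> (1 + \<epsilon>) * v\<^sup>2 + (4 + 4 / \<epsilon>) * b\<^sup>2"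
proof -
  have "u \<le> v + 2 * b"
  proof (rule ccontr)
    assume "\<not> u \<le> v + 2 * b"
    hence "(u + v) * (2 * b) < (u + v) * (u - v)"
      using assms by (intro mult_strict_left_mono) auto
    thus False using assms(5) by (simp add: power2_eq_square algebra_simps)
  qed
  hence "u\<^sup>2 \<le> (v + 2 * b)\<^sup>2" using assms by (intro power_mono) auto
  moreover have "0 \<le> (\<epsilon> * v - 2 * b)\<^sup>2 / \<epsilon>" using assms by simp
  hence "0 \<le> \<epsilon> * v\<^sup>2 - 4 * v * b + 4 / \<epsilon> * b\<^sup>2"
    using assms by (simp add: power2_eq_square field_simps)
  ultimately show ?thesis by (simp add: power2_eq_square algebra_simps)
qed

text \<open>The factor in front of the weighted l1 norm in \<open>pen\<close>, with the dictionary
  size and the sample size passed as reals.\<close>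

definition pen_level :: "real \<Rightarrow> real \<Rightarrow> real \<Rightarrow> real" where
  "pen_level \<sigma> m n = 2 * sqrt 2 * \<sigma> * sqrt ((ln m + ln n) / n)"

text \<open>The hypothesis \<open>noise\<close> does not involve \<open>lam\<close>, so one
  exceptional event serves all competitors at once.\<close>

lemma oracle_inequality:
  fixes X :: "'n::finite \<Rightarrow> 'x" and F :: "'m::finite \<Rightarrow> 'x \<Rightarrow> real" and \<sigma> \<kappa> \<epsilon> :: real
  defines "t \<equiv> pen_level \<sigma> (real CARD('m)) (real CARD('n))"
  assumes "0 \<le> \<sigma>" "0 < \<kappa>" "pos_semidef (gram X F - \<kappa> *\<^sub>R diag_gram X F)" "0 < \<epsilon>"
    and min: "is_arg_min (criterion \<sigma> X F (\<chi> i. f (X i) + w i)) (\<lambda>_. True) lh"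
    and noise: "\<And>j. 2 * \<bar>\<Sum>i\<in>UNIV. F j (X i) * w i\<bar> \<le> real CARD('n) * (t * emp_norm X (F j))"
  shows "(emp_norm X (\<lambda>x. lin_comb F lh x - f x))\<^sup>2
     \<le> (1 + \<epsilon>) * (emp_norm X (\<lambda>x. lin_comb F lam x - f x))\<^sup>2
       + (4 + 4 / \<epsilon>) * (t\<^sup>2 / \<kappa> * real (num_nonzero lam))"
proof -
  define n where "n = real CARD('n)"
  have n0: "0 < n" by (simp add: n_def)
  have n1: "1 \<le> n" unfolding n_def by (simp add: Suc_leI)
  have m1: "1 \<le> real CARD('m)" by (simp add: Suc_leI)
  have t0: "0 \<le> t" unfolding t_def pen_level_def n_def[symmetric]
    using \<open>0 \<le> \<sigma>\<close> n1 m1 by (intro mult_nonneg_nonneg real_sqrt_ge_zero divide_nonneg_nonneg) auto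
  define e where "e j = emp_norm X (F j)" for j
  have e0: "0 \<le> e j" for j by (simp add: e_def emp_norm_nonneg)
  define u where "u = emp_norm X (\<lambda>x. lin_comb F lh x - f x)"
  define v where "v = emp_norm X (\<lambda>x. lin_comb F lam x - f x)"
  define J where "J = {j. lam $ j \<noteq> 0}"
  define \<delta> where "\<delta> = lh - lam"
  have pen: "pen \<sigma> X F l = (\<Sum>j\<in>UNIV. t * e j * \<bar>l $ j\<bar>)" for l
    unfolding pen_def t_def pen_level_def e_def sum_distrib_left
    by (intro sum.cong refl) (simp only: mult_ac)
  have "criterion \<sigma> X F (\<chi> i. f (X i) + w i) lh \<le> criterion \<sigma> X F (\<chi> i. f (X i) + w i) lam"
    using min unfolding is_arg_min_linorder by blast
  \<comment> \<open>The noise energy is the same at both parameters and cancels; the noise survives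
    only through its correlation with \<open>lin_comb F \<delta>\<close>.\<close>
  hence basic: "u\<^sup>2 \<le> v\<^sup>2 + (2 / n) * (\<Sum>i\<in>UNIV. w i * lin_comb F \<delta> (X i)) + pen \<sigma> X F lam - pen \<sigma> X F lh"
    unfolding criterion_expand u_def v_def n_def \<delta>_def lin_comb_diff
    by (simp add: right_diff_distrib sum_subtractf)
  have "(\<Sum>i\<in>UNIV. w i * lin_comb F \<delta> (X i)) = (\<Sum>i\<in>UNIV. \<Sum>j\<in>UNIV. \<delta> $ j * (F j (X i) * w i))"
    by (simp add: lin_comb_def sum_distrib_left mult_ac)
  also have "\<dots> = (\<Sum>j\<in>UNIV. \<delta> $ j * (\<Sum>i\<in>UNIV. F j (X i) * w i))"
    by (subst sum.swap) (simp add: sum_distrib_left)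
  finally have "(2 / n) * (\<Sum>i\<in>UNIV. w i * lin_comb F \<delta> (X i)) 
      = (\<Sum>j\<in>UNIV. \<delta> $ j * ((2 / n) * (\<Sum>i\<in>UNIV. F j (X i) * w i)))"
    by (simp add: sum_distrib_left mult_ac)
  also have "\<dots> \<le> (\<Sum>j\<in>UNIV. t * e j * \<bar>\<delta> $ j\<bar>)"
  proof (rule sum_mono)
    fix j
    have "\<bar>(2 / n) * (\<Sum>i\<in>UNIV. F j (X i) * w i)\<bar> \<le> t * e j"
      using noise[of j] n0 unfolding n_def[symmetric] e_def[symmetric]
      by (simp add: abs_mult field_simps)
    hence "\<bar>\<delta> $ j\<bar> * \<bar>(2 / n) * (\<Sum>i\<in>UNIV. F j (X i) * w i)\<bar> \<le> \<bar>\<delta> $ j\<bar> * (t * e j)"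
      by (rule mult_left_mono) simp
    hence "\<bar>\<delta> $ j * ((2 / n) * (\<Sum>i\<in>UNIV. F j (X i) * w i))\<bar> \<le> \<bar>\<delta> $ j\<bar> * (t * e j)"
      by (simp only: abs_mult[of "\<delta> $ j"])
    thus "\<delta> $ j * ((2 / n) * (\<Sum>i\<in>UNIV. F j (X i) * w i)) \<le> t * e j * \<bar>\<delta> $ j\<bar>"
      by (simp only: mult.commute[of "t * e j"] abs_le_D1)
  qed
  finally have "u\<^sup>2 \<le> v\<^sup>2 + (\<Sum>j\<in>UNIV. t * e j * (\<bar>\<delta> $ j\<bar> + \<bar>lam $ j\<bar> - \<bar>lh $ j\<bar>))"
    using basic unfolding pen by (simp add: sum.distrib sum_subtractf distrib_left right_diff_distrib)
  \<comment> \<open>Outside \<open>J\<close> the coordinate of \<open>lam\<close> is zero, so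
    \<open>\<delta> $ j = lh $ j\<close> and the bracket vanishes; inside \<open>J\<close> the
    triangle inequality bounds it by \<open>2 * \<bar>\<delta> $ j\<bar>\<close>.\<close>
  also have "(\<Sum>j\<in>UNIV. t * e j * (\<bar>\<delta> $ j\<bar> + \<bar>lam $ j\<bar> - \<bar>lh $ j\<bar>))
      \<le> (\<Sum>j\<in>UNIV. t * e j * (if j \<in> J then 2 * \<bar>\<delta> $ j\<bar> else 0))"
    using t0 e0 by (intro sum_mono mult_left_mono) (auto simp: J_def \<delta>_def)
  also have "\<dots> = 2 * t * (\<Sum>j\<in>J. \<bar>\<delta> $ j * e j\<bar>)"
    using e0 by (simp add: sum_distrib_left if_distrib sum.If_cases abs_mult mult_ac cong: if_cong)
  also have "\<dots> \<le> 2 * t * (sqrt (real (num_nonzero lam) / \<kappa>) * (u + v))"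
  proof -
    \<comment> \<open>Cauchy-Schwarz against the constant 1 brings in the square root of the support
      size.\<close>
    have "(\<Sum>j\<in>J. \<bar>\<delta> $ j * e j\<bar>) = (\<Sum>j\<in>J. \<bar>1\<bar> * \<bar>\<delta> $ j * e j\<bar>)" by simp
    also have "\<dots> \<le> L2_set (\<lambda>_. 1) J * L2_set (\<lambda>j. \<delta> $ j * e j) J"
      by (rule L2_set_mult_ineq)
    also have "L2_set (\<lambda>_. 1) J = sqrt (real (num_nonzero lam))"
      by (simp add: L2_set_def num_nonzero_def J_def)
    also have "L2_set (\<lambda>j. \<delta> $ j * e j) J \<le> (u + v) / sqrt \<kappa>"
    proof -
      have "\<kappa> * (\<Sum>j\<in>J. (\<delta> $ j * e j)\<^sup>2) \<le> \<kappa> * (\<Sum>j\<in>UNIV. (\<delta> $ j * e j)\<^sup>2)"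
        using \<open>0 < \<kappa>\<close> by (intro mult_left_mono sum_mono2) auto
      also have "\<dots> \<le> (emp_norm X (\<lambda>x. lin_comb F lh x - lin_comb F lam x))\<^sup>2"
        using diag_gram_bound[OF assms(4), of \<delta>] unfolding e_def \<delta>_def
        by (simp add: lin_comb_diff emp_norm_def)
      \<comment> \<open>The distance between estimator and competitor is measured through
        \<open>f\<close>.\<close>
      also have "\<dots> \<le> (u + v)\<^sup>2"
        unfolding u_def v_def by (intro power_mono emp_norm_triangle emp_norm_nonneg)
      finally have "(\<Sum>j\<in>J. (\<delta> $ j * e j)\<^sup>2) \<le> (u + v)\<^sup>2 / \<kappa>"
        using \<open>0 < \<kappa>\<close> by (simp add: field_simps)
      hence "L2_set (\<lambda>j. \<delta> $ j * e j) J \<le> sqrt ((u + v)\<^sup>2 / \<kappa>)"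
        unfolding L2_set_def by (rule real_sqrt_le_mono)
      thus ?thesis by (simp add: real_sqrt_divide u_def v_def emp_norm_nonneg)
    qed
    finally have "(\<Sum>j\<in>J. \<bar>\<delta> $ j * e j\<bar>) \<le> sqrt (real (num_nonzero lam) / \<kappa>) * (u + v)"
      by (simp add: real_sqrt_divide mult_left_mono)
    thus ?thesis using t0 by (intro mult_left_mono) auto
  qed
  finally have "u\<^sup>2 \<le> v\<^sup>2 + 2 * (t * sqrt (real (num_nonzero lam) / \<kappa>)) * (u + v)"
    by (simp add: mult_ac)
  hence "u\<^sup>2 \<le> (1 + \<epsilon>) * v\<^sup>2 + (4 + 4 / \<epsilon>) * (t * sqrt (real (num_nonzero lam) / \<kappa>))\<^sup>2"
    using assms t0 by (intro quadratic_self_bound) (auto simp: u_def v_def emp_norm_nonneg)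
  thus ?thesis
    using \<open>0 < \<kappa>\<close> by (simp add: u_def v_def power_mult_distrib)
qed

text \<open>The penalty is nonnegative and vanishes at zero, so the residuals at \<open>lh\<close>
  have no more energy than the responses. Using
  \<open>(a + b)\<^sup>2 \<le> 2 * a\<^sup>2 + 2 * b\<^sup>2\<close> twice gives the constants:
  \<open>2 * (2 * L\<^sup>2 + 2 * w\<^sup>2) + 2 * w\<^sup>2\<close> for each design point.\<close>

lemma crude_bound:
  fixes X :: "'n::finite \<Rightarrow> 'x" and F :: "'m::finite \<Rightarrow> 'x \<Rightarrow> real"
  assumes "0 \<le> \<sigma>" and bd: "\<And>i. \<bar>f (X i)\<bar> \<le> L"
    and min: "is_arg_min (criterion \<sigma> X F (\<chi> i. f (X i) + w i)) (\<lambda>_. True) lh"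
  shows "(emp_norm X (\<lambda>x. lin_comb F lh x - f x))\<^sup>2
     \<le> 4 * L\<^sup>2 + 6 * ((1 / real CARD('n)) * (\<Sum>i\<in>UNIV. (w i)\<^sup>2))"
proof -
  define n where "n = real CARD('n)"
  have n0: "0 < n" by (simp add: n_def)
  have "1 \<le> real CARD('n)" "1 \<le> real CARD('m)" by (simp_all add: Suc_leI)
  hence pen: "0 \<le> pen \<sigma> X F lh"
    unfolding pen_def using \<open>0 \<le> \<sigma>\<close>
    by (intro mult_nonneg_nonneg real_sqrt_ge_zero divide_nonneg_nonneg sum_nonneg) (auto simp: emp_norm_nonneg)
  have "criterion \<sigma> X F (\<chi> i. f (X i) + w i) lh \<le> criterion \<sigma> X F (\<chi> i. f (X i) + w i) 0"
    using min unfolding is_arg_min_linorder by blast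
  hence "(1 / n) * (\<Sum>i\<in>UNIV. (f (X i) + w i - lin_comb F lh (X i))\<^sup>2) + pen \<sigma> X F lh 
      \<le> (1 / n) * (\<Sum>i\<in>UNIV. (f (X i) + w i)\<^sup>2)"
    by (simp add: criterion_def pen_def n_def lin_comb_def)
  hence *: "(\<Sum>i\<in>UNIV. (f (X i) + w i - lin_comb F lh (X i))\<^sup>2) \<le> (\<Sum>i\<in>UNIV. (f (X i) + w i)\<^sup>2)"
    using pen n0 by (simp add: divide_le_cancel) (smt (verit) divide_le_cancel)
  have "(\<Sum>i\<in>UNIV. (lin_comb F lh (X i) - f (X i))\<^sup>2) 
     \<le> (\<Sum>i\<in>UNIV. 2 * (f (X i) + w i - lin_comb F lh (X i))\<^sup>2 + 2 * (w i)\<^sup>2)"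
  proof (rule sum_mono)
    fix i
    show "(lin_comb F lh (X i) - f (X i))\<^sup>2 \<le> 2 * (f (X i) + w i - lin_comb F lh (X i))\<^sup>2 + 2 * (w i)\<^sup>2"
      using zero_le_power2[of "f (X i) + 2 * w i - lin_comb F lh (X i)"]
      by (simp add: power2_eq_square algebra_simps)
  qed
  also have "\<dots> \<le> 2 * (\<Sum>i\<in>UNIV. (f (X i) + w i)\<^sup>2) + 2 * (\<Sum>i\<in>UNIV. (w i)\<^sup>2)"
    using * by (simp add: sum.distrib sum_distrib_left[symmetric])
  also have "\<dots> = (\<Sum>i\<in>UNIV. 2 * (f (X i) + w i)\<^sup>2 + 2 * (w i)\<^sup>2)"
    by (simp add: sum.distrib sum_distrib_left)
  also have "\<dots> \<le> (\<Sum>i\<in>(UNIV::'n set). 4 * L\<^sup>2 + 6 * (w i)\<^sup>2)"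
  proof (rule sum_mono)
    fix i
    have "(f (X i))\<^sup>2 \<le> L\<^sup>2" using bd[of i] by (intro iffD1[OF abs_le_square_iff]) linarith
    thus "2 * (f (X i) + w i)\<^sup>2 + 2 * (w i)\<^sup>2 \<le> 4 * L\<^sup>2 + 6 * (w i)\<^sup>2"
      using zero_le_power2[of "f (X i) - w i"] by (simp add: power2_eq_square algebra_simps)
  qed
  also have "\<dots> = n * (4 * L\<^sup>2) + 6 * (\<Sum>i\<in>UNIV. (w i)\<^sup>2)"
    by (simp add: sum.distrib sum_distrib_left n_def)
  finally show ?thesis
    unfolding emp_norm_sq n_def[symmetric] using n0 by (simp add: field_simps)
qed

section \<open>A numerical inequality for the exponential remainder\<close>

text \<open>
  After squaring, the claim is \<open>16/9 * q ^ n \<le> (n + 2) / n\<close> with \<open>q = 4/3 * exp (- 3/8)\<close>, and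
  Bernoulli's inequality applies to \<open>1/q \<ge> 1 + 2/25\<close>.
\<close>
lemma exp_tail_constant:
  fixes n :: real
  assumes "1 \<le> n" "n = real k"
  shows "4 / 3 * (sqrt (4 / 3) ^ k * exp (- (n / 4))) \<le> sqrt ((n + 2) / n) * exp (- (n / 16))"
proof -
  define q :: real where "q = 4 / 3 * exp (- (3 / 8))"
  have q0: "0 < q" by (simp add: q_def)
  \<comment> \<open>The quadratic Taylor polynomial at 3/8 equals 185/128, just above 36/25, and 3/4
    * 36/25 = 1 + 2/25.\<close>
  have "36 / 25 \<le> exp (3 / 8 :: real)"
    using exp_lower_Taylor_quadratic[of "3 / 8 :: real"] by (simp add: power2_eq_square)
  hence "1 + 2 / 25 \<le> 1 / q"
    by (simp add: q_def exp_minus field_simps)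
  hence "(1 + 2 / 25) ^ k \<le> (1 / q) ^ k" by (rule power_mono) simp
  moreover have "1 + real k * (2 / 25) \<le> (1 + 2 / 25 :: real) ^ k"
    by (rule Bernoulli_inequality) simp
  ultimately have "1 + 2 / 25 * n \<le> 1 / q ^ k"
    using assms(2) by (simp add: power_one_over mult_ac)
  moreover have "16 / 9 * n \<le> (n + 2) * (1 + 2 / 25 * n)"
  proof -
    have "(n + 2) * (1 + 2 / 25 * n) = 2 / 25 * (n * n) + 29 / 25 * n + 2"
      by (simp add: field_simps)
    \<comment> \<open>The tangent to the square at 4 reduces the claim to the linear inequality
      \<open>16 / 9 * n \<le> 9 / 5 * n + 18 / 25\<close>.\<close>
    moreover have "8 * n - 16 \<le> n * n"
      using zero_le_power2[of "n - 4"] by (simp add: power2_eq_square algebra_simps)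
    ultimately show ?thesis using assms(1) by linarith
  qed
  ultimately have "16 / 9 * n \<le> (n + 2) * (1 / q ^ k)"
    using assms(1) by (smt (verit) mult_left_mono)
  hence 1: "16 / 9 * q ^ k \<le> (n + 2) / n"
    using assms(1) q0 by (simp add: field_simps)
  have "sqrt (16 / 9 * q ^ k) = 4 / 3 * (sqrt (4 / 3) ^ k * sqrt (exp (- (3 / 8))) ^ k)"
    by (simp add: q_def real_sqrt_mult real_sqrt_power power_mult_distrib real_sqrt_divide power_divide)
  also have "sqrt (exp (- (3 / 8))) = exp (- (3 / 16) :: real)"
    by (rule real_sqrt_unique) (simp_all add: power2_eq_square exp_add[symmetric])
  \<comment> \<open>Since 3/16 = 1/4 - 1/16, the factor \<open>exp (n / 16)\<close> can be moved to
    the other side.\<close>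
  also have "exp (- (3 / 16)) ^ k = exp (- (n / 4)) * exp (n / 16)"
    by (simp add: exp_of_nat_mult[symmetric] exp_add[symmetric] assms(2))
  finally have "4 / 3 * (sqrt (4 / 3) ^ k * (exp (- (n / 4)) * exp (n / 16))) \<le> sqrt ((n + 2) / n)"
    using real_sqrt_le_mono[OF 1] by (simp only:)
  hence "4 / 3 * (sqrt (4 / 3) ^ k * (exp (- (n / 4)) * exp (n / 16))) * exp (- (n / 16))
      \<le> sqrt ((n + 2) / n) * exp (- (n / 16))"
    by (rule mult_right_mono) simp
  thus ?thesis by (simp add: mult.assoc exp_add[symmetric])
qed

section \<open>Gaussian tails of the noise correlations\<close>

text \<open>Mills' trick: on \<open>{a * s..}\<close> the factor \<open>x / (a * s) \<ge> 1\<close> makes the density integrable in closed form.\<close>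
lemma normal_upper_tail:
  assumes "0 < s" "0 < a"
  shows "(\<integral>\<^sup>+x. ennreal (normal_density 0 s x) * indicator {a * s..} x \<partial>lborel)
     \<le> ennreal (exp (- (a\<^sup>2 / 2)) / (a * sqrt (2 * pi)))"
proof -
  have "(\<integral>\<^sup>+x. ennreal (normal_density 0 s x) * indicator {a * s..} x \<partial>lborel)
      \<le> (\<integral>\<^sup>+x. ennreal (x / (a * s) * normal_density 0 s x) * indicator {a * s..} x \<partial>lborel)"
  proof (rule nn_integral_mono)
    fix x
    show "ennreal (normal_density 0 s x) * indicator {a * s..} x
       \<le> ennreal (x / (a * s) * normal_density 0 s x) * indicator {a * s..} x"
    proof (cases "a * s \<le> x")
      case True
      hence "1 * normal_density 0 s x \<le> x / (a * s) * normal_density 0 s x"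
        using assms by (intro mult_right_mono) (auto simp: field_simps)
      thus ?thesis using True by (simp add: ennreal_leI)
    qed simp
  qed
  \<comment> \<open>The derivative of the density is \<open>- x / s\<^sup>2\<close> times the
    density, which dictates the factor \<open>- (s / a)\<close> in the antiderivative.\<close>
  also have "\<dots> = ennreal (0 - (- (s / a) * normal_density 0 s (a * s)))"
  proof (rule nn_integral_FTC_atLeast)
    fix x
    show "((\<lambda>x. - (s / a) * normal_density 0 s x) has_real_derivative x / (a * s) * normal_density 0 s x) (at x)"
      unfolding normal_density_def using assms
      by (auto intro!: derivative_eq_intros simp: field_simps power2_eq_square)
  next
    fix x assume "a * s \<le> x"
    moreover have "0 < a * s" using assms by simp
    ultimately have "0 \<le> x / (a * s)" by (intro divide_nonneg_pos) linarith+
    thus "0 \<le> x / (a * s) * normal_density 0 s x" by (rule mult_nonneg_nonneg) simp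
  next
    have "(normal_density 0 s \<longlongrightarrow> 0) at_top"
      unfolding normal_density_def using assms by real_asymp
    from tendsto_mult_right_zero[OF this, of "- (s / a)"]
    show "((\<lambda>x. - (s / a) * normal_density 0 s x) \<longlongrightarrow> 0) at_top" .
  qed simp
  also have "0 - (- (s / a) * normal_density 0 s (a * s)) = exp (- (a\<^sup>2 / 2)) / (a * sqrt (2 * pi))"
    using assms by (simp add: normal_density_def real_sqrt_mult power_mult_distrib field_simps)
  finally show ?thesis .
qed

text \<open>By symmetry of the centred normal law, the upper tail bound applies to both
  \<open>Z\<close> and \<open>- Z\<close>.\<close>

lemma (in prob_space) normal_two_sided_tail:
  assumes D: "distributed M lborel Z (normal_density 0 s)" and "0 < s" "0 < a"
  shows "prob {\<omega> \<in> space M. a * s < \<bar>Z \<omega>\<bar>} \<le> 2 * exp (- (a\<^sup>2 / 2)) / (a * sqrt (2 * pi))"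
proof -
  have [measurable]: "Z \<in> borel_measurable M"
    using distributed_measurable[OF D] by simp
  have tail: "prob {\<omega> \<in> space M. a * s \<le> Z' \<omega>} \<le> exp (- (a\<^sup>2 / 2)) / (a * sqrt (2 * pi))"
    if D': "distributed M lborel Z' (normal_density 0 s)" for Z'
  proof -
    have "emeasure M (Z' -` {a * s..} \<inter> space M) = (\<integral>\<^sup>+x. ennreal (normal_density 0 s x) * indicator {a * s..} x \<partial>lborel)"
      using D' by (rule distributed_emeasure) simp
    also have "\<dots> \<le> ennreal (exp (- (a\<^sup>2 / 2)) / (a * sqrt (2 * pi)))"
      using assms by (intro normal_upper_tail)
    also have "Z' -` {a * s..} \<inter> space M = {\<omega> \<in> space M. a * s \<le> Z' \<omega>}" by auto
    finally show ?thesis using assms by (simp add: emeasure_eq_measure)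
  qed
  have "distributed M lborel (\<lambda>x. 0 + (- 1) * Z x) (normal_density (0 + (- 1) * 0) (\<bar>- 1\<bar> * s))"
    using assms by (intro normal_density_affine) auto
  hence D': "distributed M lborel (\<lambda>x. - Z x) (normal_density 0 s)" by simp
  have "prob {\<omega> \<in> space M. a * s < \<bar>Z \<omega>\<bar>} 
      \<le> prob ({\<omega> \<in> space M. a * s \<le> Z \<omega>} \<union> {\<omega> \<in> space M. a * s \<le> - Z \<omega>})"
    by (rule finite_measure_mono) auto
  also have "\<dots> \<le> prob {\<omega> \<in> space M. a * s \<le> Z \<omega>} + prob {\<omega> \<in> space M. a * s \<le> - Z \<omega>}"
    by (rule measure_Un_le) auto
  finally show ?thesis using tail[OF D] tail[OF D'] by simp
qed

text \<open>Zero coefficients are dropped in the proof: \<open>normal_density 0 0\<close> is the zero function.\<close>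
lemma (in prob_space) linear_combination_normal:
  fixes W :: "'i \<Rightarrow> 'a \<Rightarrow> real"
  assumes "finite I" "indep_vars (\<lambda>_. borel) W I" "0 < \<sigma>"
    and "\<And>i. i \<in> I \<Longrightarrow> distributed M lborel (W i) (normal_density 0 \<sigma>)"
    and "\<exists>i\<in>I. c i \<noteq> 0"
  shows "distributed M lborel (\<lambda>\<omega>. \<Sum>i\<in>I. c i * W i \<omega>) (normal_density 0 (\<sigma> * sqrt (\<Sum>i\<in>I. (c i)\<^sup>2)))"
proof -
  define K where "K = {i \<in> I. c i \<noteq> 0}"
  have "distributed M lborel (\<lambda>x. \<Sum>i\<in>K. c i * W i x)
     (normal_density (\<Sum>i\<in>K. 0) (sqrt (\<Sum>i\<in>K. (\<bar>c i\<bar> * \<sigma>)\<^sup>2)))"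
  proof (rule sum_indep_normal)
    show "indep_vars (\<lambda>i. borel) (\<lambda>i x. c i * W i x) K"
      using indep_vars_subset[OF assms(2), of K]
      by (intro indep_vars_compose2[where Y = "\<lambda>i x. c i * x"]) (auto simp: K_def)
  next
    fix i assume i: "i \<in> K"
    hence "distributed M lborel (\<lambda>x. 0 + c i * W i x) (normal_density (0 + c i * 0) (\<bar>c i\<bar> * \<sigma>))"
      using assms by (intro normal_density_affine) (auto simp: K_def)
    thus "distributed M lborel (\<lambda>x. c i * W i x) (normal_density 0 (\<bar>c i\<bar> * \<sigma>))" by simp
    show "0 < \<bar>c i\<bar> * \<sigma>" using i assms by (simp add: K_def)
  qed (use assms in \<open>auto simp: K_def\<close>)
  moreover have "(\<Sum>i\<in>K. c i * W i x) = (\<Sum>i\<in>I. c i * W i x)" for x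
    using assms(1) by (intro sum.mono_neutral_left) (auto simp: K_def)
  moreover have "(\<Sum>i\<in>K. (\<bar>c i\<bar> * \<sigma>)\<^sup>2) = (\<Sum>i\<in>I. \<sigma>\<^sup>2 * (c i)\<^sup>2)"
    using assms(1) by (intro sum.mono_neutral_cong_left) (auto simp: K_def power_mult_distrib)
  ultimately show ?thesis
    using assms(3) by (simp add: sum_distrib_left[symmetric] real_sqrt_mult)
qed

text \<open>The threshold is \<open>a\<close> standard deviations of the sum, so the bound is the
  same for all \<open>c\<close>. If all coefficients vanish, the strict inequality makes the event
  empty.\<close>

lemma (in prob_space) normal_correlation_tail:
  fixes W :: "'i \<Rightarrow> 'a \<Rightarrow> real"
  assumes "finite I" "indep_vars (\<lambda>_. borel) W I" "0 < \<sigma>" "0 < a"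
    and "\<And>i. i \<in> I \<Longrightarrow> distributed M lborel (W i) (normal_density 0 \<sigma>)"
  shows "prob {\<omega> \<in> space M. a * (\<sigma> * sqrt (\<Sum>i\<in>I. (c i)\<^sup>2)) < \<bar>\<Sum>i\<in>I. c i * W i \<omega>\<bar>}
     \<le> 2 * exp (- (a\<^sup>2 / 2)) / (a * sqrt (2 * pi))"
proof (cases "\<exists>i\<in>I. c i \<noteq> 0")
  case True
  hence "0 < (\<Sum>i\<in>I. (c i)\<^sup>2)"
    using assms(1) by (auto intro!: sum_pos2)
  thus ?thesis
    using assms True by (intro normal_two_sided_tail linear_combination_normal) auto
next
  case False
  thus ?thesis using assms by simp
qed

section \<open>Exponential moments of the noise energy\<close>

lemma normal_exp_square_moments:
  assumes "0 < \<sigma>"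
  shows "has_bochner_integral lborel (\<lambda>x. normal_density 0 \<sigma> x * exp (x\<^sup>2 / (8 * \<sigma>\<^sup>2))) (sqrt (4 / 3))"
    and "has_bochner_integral lborel (\<lambda>x. normal_density 0 \<sigma> x * (x\<^sup>2 * exp (x\<^sup>2 / (8 * \<sigma>\<^sup>2))))
           (4 / 3 * \<sigma>\<^sup>2 * sqrt (4 / 3))"
proof -
  \<comment> \<open>The exponents combine as \<open>1 / (2 * \<sigma>\<^sup>2) - 1 / (8 *
    \<sigma>\<^sup>2) = 3 / (8 * \<sigma>\<^sup>2)\<close>, which is
    \<open>1 / (2 * \<tau>\<^sup>2)\<close> for this \<open>\<tau>\<close>.\<close>
  define \<tau> where "\<tau> = \<sigma> * sqrt (4 / 3)"
  have "0 < \<tau>" using assms by (simp add: \<tau>_def)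
  \<comment> \<open>the exponential weight turns the \<open>N(0, \<sigma>\<^sup>2)\<close> density into a multiple of the \<open>N(0, \<tau>\<^sup>2)\<close> density\<close>
  have *: "normal_density 0 \<sigma> x * exp (x\<^sup>2 / (8 * \<sigma>\<^sup>2)) = sqrt (4 / 3) * normal_density 0 \<tau> x" for x
  proof -
    have "exp (- (x\<^sup>2 / (2 * \<sigma>\<^sup>2))) * exp (x\<^sup>2 / (8 * \<sigma>\<^sup>2)) = exp (- (x\<^sup>2 / (2 * \<tau>\<^sup>2)))"
      using assms by (simp add: exp_add[symmetric] \<tau>_def power_mult_distrib field_simps)
    moreover have "sqrt (2 * pi * \<tau>\<^sup>2) = sqrt (2 * pi * \<sigma>\<^sup>2) * sqrt (4 / 3)"
      by (simp add: \<tau>_def power_mult_distrib real_sqrt_mult[symmetric] mult_ac)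
    ultimately show ?thesis
      using \<open>0 < \<tau>\<close> by (simp add: normal_density_def)
  qed
  have "has_bochner_integral lborel (\<lambda>x. sqrt (4 / 3) * (normal_density 0 \<tau> x * (x - 0) ^ (2 * k)))
      (sqrt (4 / 3) * (fact (2 * k) / ((2 / \<tau>\<^sup>2) ^ k * fact k)))" for k
    by (intro has_bochner_integral_mult_right normal_moment_even \<open>0 < \<tau>\<close>)
  from this[of 0] this[of 1] show
    "has_bochner_integral lborel (\<lambda>x. normal_density 0 \<sigma> x * exp (x\<^sup>2 / (8 * \<sigma>\<^sup>2))) (sqrt (4 / 3))"
    "has_bochner_integral lborel (\<lambda>x. normal_density 0 \<sigma> x * (x\<^sup>2 * exp (x\<^sup>2 / (8 * \<sigma>\<^sup>2))))
           (4 / 3 * \<sigma>\<^sup>2 * sqrt (4 / 3))"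
    unfolding mult.left_commute[of "normal_density 0 \<sigma> _"] *
    by (simp_all add: \<tau>_def power_mult_distrib mult_ac)
qed

text \<open>The exponential of the sum is a product over the coordinates. Distributing the sum in
  front of it leaves, for each \<open>i\<close>, a product of independent factors
  \<open>g i k (W k \<omega>)\<close> in which only \<open>k = i\<close> carries an extra square, so
  the one-dimensional moments suffice.\<close>

lemma (in prob_space) sum_squares_exp_moment:
  fixes W :: "'i \<Rightarrow> 'a \<Rightarrow> real"
  assumes fin: "finite I" and ind: "indep_vars (\<lambda>_. borel) W I" and s: "0 < \<sigma>"
    and D: "\<And>i. i \<in> I \<Longrightarrow> distributed M lborel (W i) (normal_density 0 \<sigma>)"
  shows "has_bochner_integral M
     (\<lambda>\<omega>. (\<Sum>i\<in>I. (W i \<omega>)\<^sup>2) * exp ((\<Sum>i\<in>I. (W i \<omega>)\<^sup>2) / (8 * \<sigma>\<^sup>2)))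
     (real (card I) * (4 / 3 * \<sigma>\<^sup>2) * sqrt (4 / 3) ^ card I)"
proof -
  define g where "g i k x = (if k = i then x\<^sup>2 else 1) * exp (x\<^sup>2 / (8 * \<sigma>\<^sup>2))" for i k :: 'i and x :: real
  have [measurable]: "g i k \<in> borel_measurable borel" for i k
    unfolding g_def by (cases "k = i") simp_all
  have gW: "has_bochner_integral M (\<lambda>\<omega>. g i k (W k \<omega>)) ((if k = i then 4 / 3 * \<sigma>\<^sup>2 else 1) * sqrt (4 / 3))"
    if "k \<in> I" for i k
  proof -
    have "has_bochner_integral lborel (\<lambda>x. normal_density 0 \<sigma> x * g i k x) ((if k = i then 4 / 3 * \<sigma>\<^sup>2 else 1) * sqrt (4 / 3))"
      using normal_exp_square_moments[OF s] by (cases "k = i") (simp_all add: g_def)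
    thus ?thesis
      using distributed_integrable[OF D[OF that], of "g i k"] distributed_integral[OF D[OF that], of "g i k"]
      by (simp add: has_bochner_integral_iff)
  qed
  have prod: "has_bochner_integral M (\<lambda>\<omega>. \<Prod>k\<in>I. g i k (W k \<omega>)) (4 / 3 * \<sigma>\<^sup>2 * sqrt (4 / 3) ^ card I)"
    if "i \<in> I" for i
  proof -
    have iv: "indep_vars (\<lambda>_. borel) (\<lambda>k \<omega>. g i k (W k \<omega>)) I"
      using ind by (rule indep_vars_compose2) simp
    have int: "\<And>k. k \<in> I \<Longrightarrow> integrable M (\<lambda>\<omega>. g i k (W k \<omega>))"
      using gW by (simp add: has_bochner_integral_iff)
    have "(\<integral>\<omega>. (\<Prod>k\<in>I. g i k (W k \<omega>)) \<partial>M) = (\<Prod>k\<in>I. (if k = i then 4 / 3 * \<sigma>\<^sup>2 else 1) * sqrt (4 / 3))"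
      using indep_vars_lebesgue_integral[OF fin iv int] gW
      by (simp add: has_bochner_integral_iff)
    also have "\<dots> = 4 / 3 * \<sigma>\<^sup>2 * sqrt (4 / 3) ^ card I"
      unfolding prod.distrib using that fin by (simp add: prod.delta)
    finally show ?thesis
      using indep_vars_integrable[OF fin iv int] by (simp add: has_bochner_integral_iff)
  qed
  have "has_bochner_integral M (\<lambda>\<omega>. \<Sum>i\<in>I. \<Prod>k\<in>I. g i k (W k \<omega>)) (\<Sum>i\<in>I. 4 / 3 * \<sigma>\<^sup>2 * sqrt (4 / 3) ^ card I)"
    using prod by (rule has_bochner_integral_sum)
  moreover have "(\<Sum>i\<in>I. \<Prod>k\<in>I. g i k (W k \<omega>)) 
      = (\<Sum>i\<in>I. (W i \<omega>)\<^sup>2) * exp ((\<Sum>i\<in>I. (W i \<omega>)\<^sup>2) / (8 * \<sigma>\<^sup>2))" for \<omega>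
    unfolding g_def prod.distrib sum_distrib_right
    using fin by (intro sum.cong refl) (simp add: prod.delta exp_sum[symmetric] sum_divide_distrib)
  ultimately show ?thesis by (simp add: mult_ac)
qed

section \<open>Measurability of the loss and the risk bound\<close>

lemma emp_risk_measurable:
  fixes X :: "'n::finite \<Rightarrow> 'x" and F :: "'m::finite \<Rightarrow> 'x \<Rightarrow> real"
  assumes W [measurable]: "\<And>i. W i \<in> borel_measurable P"
    and lamhat [measurable]: "lamhat \<in> borel_measurable borel"
  shows "(\<lambda>\<omega>. (emp_norm X (\<lambda>x. lin_comb F (lamhat (response X f W \<omega>)) x - f x))\<^sup>2) \<in> borel_measurable P"
proof -
  have [measurable]: "response X f W \<in> borel_measurable P"
    unfolding response_def
    by (subst borel_measurable_euclidean_space) (auto simp: Basis_vec_def inner_axis)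
  have [measurable]: "(\<lambda>v :: real ^ 'm. v $ j) \<in> borel_measurable borel" for j
    by (intro borel_measurable_continuous_onI continuous_intros)
  show ?thesis
    unfolding emp_norm_sq lin_comb_def by measurable
qed

theorem theorem4p1:
  fixes P :: "'w measure"
    and S :: "(real ^ 'd::finite) set"
    and X :: "'n::finite \<Rightarrow> real ^ 'd"
    and f :: "real ^ 'd \<Rightarrow> real"
    and F :: "'m::finite \<Rightarrow> real ^ 'd \<Rightarrow> real"
    and W :: "'n \<Rightarrow> 'w \<Rightarrow> real"
    and lamhat :: "real ^ 'n \<Rightarrow> real ^ 'm"
    and L \<sigma> \<kappa> \<epsilon> :: real
  assumes prob: "prob_space P"
    and M_ge_2: "CARD('m) \<ge> 2"
    and S_borel: "S \<in> sets borel"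
    and X_in_S: "\<And>i. X i \<in> S"
    and f_bounded: "\<And>x. x \<in> S \<Longrightarrow> \<bar>f x\<bar> \<le> L"
    and F_bounded: "\<And>j x. x \<in> S \<Longrightarrow> \<bar>F j x\<bar> \<le> L"
    and sigma_nonneg: "0 \<le> \<sigma>"
    and W_indep: "prob_space.indep_vars P (\<lambda>_. borel) W UNIV"
    and W_normal: "\<And>i. distr P borel (W i) = normal_law 0 \<sigma>"
    and kappa_pos: "0 < \<kappa>"
    and kappa_psd: "pos_semidef (gram X F - \<kappa> *\<^sub>R diag_gram X F)"
    and lamhat_measurable: "lamhat \<in> borel_measurable borel"
    and lamhat_min: "\<And>\<omega>. \<omega> \<in> space P \<Longrightarrow>
          is_arg_min (criterion \<sigma> X F (response X f W \<omega>)) (\<lambda>_. True) (lamhat (response X f W \<omega>))"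
    and eps_pos: "0 < \<epsilon>"
  shows "integrable P (\<lambda>\<omega>. (emp_norm X (\<lambda>x. lin_comb F (lamhat (response X f W \<omega>)) x - f x))\<^sup>2) \<and>
    prob_space.expectation P
        (\<lambda>\<omega>. (emp_norm X (\<lambda>x. lin_comb F (lamhat (response X f W \<omega>)) x - f x))\<^sup>2)
      \<le> (INF lam :: real ^ 'm.
            (1 + \<epsilon>) * (emp_norm X (\<lambda>x. lin_comb F lam x - f x))\<^sup>2
            + 8 * (4 + \<epsilon> + 4 / \<epsilon>) * (\<sigma>\<^sup>2 / \<kappa>)
                * ((ln (real CARD('m)) + ln (real CARD('n))) / real CARD('n))
                * real (num_nonzero lam))
        + (4 * L\<^sup>2 + 12 * \<sigma>\<^sup>2)
            / (real CARD('n) * sqrt (pi * (ln (real CARD('m)) + ln (real CARD('n)))))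
        + 6 * \<sigma>\<^sup>2 * sqrt ((real CARD('n) + 2) / real CARD('n)) * exp (- (real CARD('n) / 16))"
proof -
  interpret prob_space P by (rule prob)
  define n where "n = real CARD('n)"
  define m where "m = real CARD('m)"
  define l where "l = ln m + ln n"
  define t where "t = pen_level \<sigma> m n"
  define u2 where "u2 \<omega> = (emp_norm X (\<lambda>x. lin_comb F (lamhat (response X f W \<omega>)) x - f x))\<^sup>2" for \<omega>
  define B where "B lam = (1 + \<epsilon>) * (emp_norm X (\<lambda>x. lin_comb F lam x - f x))\<^sup>2
       + (4 + 4 / \<epsilon>) * (t\<^sup>2 / \<kappa> * real (num_nonzero lam))" for lam
  \<comment> \<open>This event is the exact failure of the noise hypothesis of
    \<open>oracle_inequality\<close> for the index \<open>j\<close>.\<close>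
  define Bad where "Bad j = {\<omega> \<in> space P. n * (t * emp_norm X (F j)) < 2 * \<bar>\<Sum>i\<in>UNIV. F j (X i) * W i \<omega>\<bar>}" for j
  define R1 where "R1 = (4 * L\<^sup>2 + 12 * \<sigma>\<^sup>2) / (n * sqrt (pi * l))"
  define R2 where "R2 = 6 * \<sigma>\<^sup>2 * sqrt ((n + 2) / n) * exp (- (n / 16))"
  have n1: "1 \<le> n" unfolding n_def by (simp add: Suc_leI)
  have m2: "2 \<le> m" unfolding m_def using M_ge_2 by linarith
  have l0: "0 < l" unfolding l_def using n1 m2 by (intro add_pos_nonneg) auto
  have t2: "t\<^sup>2 = 8 * \<sigma>\<^sup>2 * (l / n)"
    unfolding t_def pen_level_def l_def[symmetric] using l0 n1
    by (simp add: power_mult_distrib)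
  have B0: "0 \<le> B lam" for lam
    unfolding B_def using eps_pos kappa_pos by simp
  \<comment> \<open>The deterministic argument gives the smaller constant
    \<open>4 + 4 / \<epsilon>\<close>; the factor 8 comes from \<open>t\<^sup>2\<close>.\<close>
  have Bt: "B lam \<le> (1 + \<epsilon>) * (emp_norm X (\<lambda>x. lin_comb F lam x - f x))\<^sup>2
            + 8 * (4 + \<epsilon> + 4 / \<epsilon>) * (\<sigma>\<^sup>2 / \<kappa>) * (l / n) * real (num_nonzero lam)" for lam
  proof -
    have "(4 + 4 / \<epsilon>) * (t\<^sup>2 / \<kappa> * real (num_nonzero lam))
        \<le> (4 + \<epsilon> + 4 / \<epsilon>) * (t\<^sup>2 / \<kappa> * real (num_nonzero lam))"
      using eps_pos kappa_pos by (intro mult_right_mono) auto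
    also have "\<dots> = 8 * (4 + \<epsilon> + 4 / \<epsilon>) * (\<sigma>\<^sup>2 / \<kappa>) * (l / n) * real (num_nonzero lam)"
    proof -
      have "c * (8 * \<sigma>\<^sup>2 * (l / n) / \<kappa> * N) = 8 * c * (\<sigma>\<^sup>2 / \<kappa>) * (l / n) * N" for c N
        by (simp add: mult_ac)
      thus ?thesis unfolding t2 .
    qed
    finally show ?thesis unfolding B_def by simp
  qed
  have R0: "0 \<le> R1" "0 \<le> R2" unfolding R1_def R2_def using n1 l0 by simp_all
  have [measurable]: "W i \<in> borel_measurable P" for i
    using W_indep unfolding indep_vars_def by simp
  have u2_meas [measurable]: "u2 \<in> borel_measurable P"
    unfolding u2_def using lamhat_measurable by (intro emp_risk_measurable) simp_all
  have u2_0: "0 \<le> u2 \<omega>" for \<omega> by (simp add: u2_def)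
  have Bad_sets [measurable]: "Bad j \<in> sets P" for j
    unfolding Bad_def by measurable
  have on_good: "u2 \<omega> \<le> B lam" if "\<omega> \<in> space P" "\<omega> \<notin> (\<Union>j. Bad j)" for \<omega> lam
    unfolding u2_def B_def t_def m_def n_def response_def
  proof (rule oracle_inequality[OF sigma_nonneg kappa_pos kappa_psd eps_pos])
    show "is_arg_min (criterion \<sigma> X F (\<chi> i. f (X i) + W i \<omega>)) (\<lambda>_. True) (lamhat (\<chi> i. f (X i) + W i \<omega>))"
      using lamhat_min[OF that(1)] by (simp add: response_def)
    show "2 * \<bar>\<Sum>i\<in>UNIV. F j (X i) * W i \<omega>\<bar>
       \<le> real CARD('n) * (pen_level \<sigma> (real CARD('m)) (real CARD('n)) * emp_norm X (F j))" for j
      using that unfolding Bad_def t_def n_def m_def by (auto simp: not_less)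
  qed
  have risk: "integrable P u2 \<and> expectation u2 \<le> B lam + R1 + R2" for lam
  proof (cases "\<sigma> = 0")
    \<comment> \<open>Without noise, both sides of the inequality defining \<open>Bad j\<close> are
      almost surely zero, so the oracle bound holds almost everywhere.\<close>
    case True
    have "AE \<omega> in P. W i \<omega> = 0" for i
    proof -
      have "AE x in distr P borel (W i). x = 0"
        unfolding W_normal normal_law_def using True by (simp add: AE_return)
      thus ?thesis by (subst (asm) AE_distr_iff) simp_all
    qed
    hence "AE \<omega> in P. \<forall>i. W i \<omega> = 0"
      by (simp add: AE_all_countable)
    hence AE: "AE \<omega> in P. u2 \<omega> \<le> B lam"
    proof (rule AE_mp, intro AE_I2 impI)
      fix \<omega> assume "\<omega> \<in> space P" "\<forall>i. W i \<omega> = 0"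
      thus "u2 \<omega> \<le> B lam"
        by (intro on_good) (auto simp: Bad_def t_def pen_level_def True)
    qed
    have int: "integrable P u2"
      using AE by (intro integrable_const_bound[where B = "B lam"]) (auto simp: u2_0)
    have "expectation u2 \<le> expectation (\<lambda>_. B lam)"
      using AE int by (intro integral_mono_AE) auto
    thus ?thesis using int R0 by (simp add: prob_space)
  next
    case False
    hence s0: "0 < \<sigma>" using sigma_nonneg by simp
    have D: "distributed P lborel (W i) (normal_density 0 \<sigma>)" for i
    proof -
      have "distr P lborel (W i) = distr P borel (W i)" by (rule distr_cong) simp_all
      thus ?thesis
        using W_normal[of i] False by (simp add: distributed_def normal_law_def)
    qed
    \<comment> \<open>With this \<open>a\<close> the event \<open>Bad j\<close> says that the
      correlation exceeds \<open>a\<close> of its standard deviations, because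
      \<open>sqrt n * t = 2 * a * \<sigma>\<close>. Moreover
      \<open>exp (- (a\<^sup>2 / 2)) = 1 / (m * n)\<close>, whose factor \<open>1 / m\<close> pays
      for the union over the dictionary.\<close>
    define a where "a = sqrt (2 * l)"
    have a0: "0 < a" unfolding a_def using l0 by simp
    have Bad_j: "prob (Bad j) \<le> 2 * exp (- (a\<^sup>2 / 2)) / (a * sqrt (2 * pi))" for j
    proof -
      have "n * (t * emp_norm X (F j)) = 2 * (a * (\<sigma> * sqrt (\<Sum>i\<in>UNIV. (F j (X i))\<^sup>2)))"
      proof -
        have "sqrt n * emp_norm X (F j) = sqrt (\<Sum>i\<in>UNIV. (F j (X i))\<^sup>2)"
          using n1 by (simp add: emp_norm_def n_def real_sqrt_divide)
        moreover have "sqrt n * t = 2 * a * \<sigma>"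
          using n1 by (simp add: t_def pen_level_def a_def l_def[symmetric] real_sqrt_divide real_sqrt_mult)
        moreover have "n * (t * emp_norm X (F j)) = (sqrt n * t) * (sqrt n * emp_norm X (F j))"
        proof -
          have "(sqrt n * t) * (sqrt n * emp_norm X (F j)) = (sqrt n * sqrt n) * (t * emp_norm X (F j))"
            by (simp only: mult_ac)
          thus ?thesis using n1 by simp
        qed
        ultimately show ?thesis by simp
      qed
      hence "Bad j = {\<omega> \<in> space P. a * (\<sigma> * sqrt (\<Sum>i\<in>UNIV. (F j (X i))\<^sup>2)) < \<bar>\<Sum>i\<in>UNIV. F j (X i) * W i \<omega>\<bar>}"
        unfolding Bad_def by auto
      thus ?thesis
        using normal_correlation_tail[OF _ W_indep s0 a0 D, of "\<lambda>i. F j (X i)"] by simp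
    qed
    have "prob (\<Union>j. Bad j) \<le> (\<Sum>j\<in>UNIV. prob (Bad j))"
      by (intro finite_measure_subadditive_finite) auto
    also have "\<dots> \<le> m * (2 * exp (- (a\<^sup>2 / 2)) / (a * sqrt (2 * pi)))"
      using sum_bounded_above[of UNIV "\<lambda>j. prob (Bad j)", OF Bad_j] by (simp add: m_def)
    also have "exp (- (a\<^sup>2 / 2)) = 1 / (m * n)"
    proof -
      have "a\<^sup>2 / 2 = l" unfolding a_def using l0 by simp
      moreover have "exp l = m * n" using n1 m2 by (simp add: l_def exp_add)
      ultimately show ?thesis by (simp add: exp_minus inverse_eq_divide)
    qed
    also have "m * (2 * (1 / (m * n)) / (a * sqrt (2 * pi))) = 1 / (n * sqrt (pi * l))"
    proof -
      have "a * sqrt (2 * pi) = 2 * sqrt (pi * l)"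
        by (simp add: a_def real_sqrt_mult)
      thus ?thesis using m2 by simp
    qed
    finally have Bad: "prob (\<Union>j. Bad j) \<le> 1 / (n * sqrt (pi * l))" .

    define E where "E \<omega> = (\<Sum>i\<in>UNIV. (W i \<omega>)\<^sup>2)" for \<omega>
    have E0: "0 \<le> E \<omega>" for \<omega> unfolding E_def by (simp add: sum_nonneg)
    define C where "C \<omega> = E \<omega> * exp (E \<omega> / (8 * \<sigma>\<^sup>2))" for \<omega>
    have C0: "0 \<le> C \<omega>" for \<omega> unfolding C_def using E0 by simp
    have C: "has_bochner_integral P C (n * (4 / 3 * \<sigma>\<^sup>2) * sqrt (4 / 3) ^ CARD('n))"
      using sum_squares_exp_moment[OF _ W_indep s0 D] unfolding C_def E_def n_def by simp
    \<comment> \<open>An integrable majorant of the loss: the oracle bound, the bounded part of the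
      crude bound on the exceptional event, and the exponentially weighted excess of the noise
      energy. All three terms are nonnegative, so they may be added on the whole space.\<close>
    define G where "G \<omega> = B lam + (4 * L\<^sup>2 + 12 * \<sigma>\<^sup>2) * indicator (\<Union>j. Bad j) \<omega> + 6 / n * exp (- (n / 4)) * C \<omega>" for \<omega>
    have le: "u2 \<omega> \<le> G \<omega>" if \<omega>: "\<omega> \<in> space P" for \<omega>
    proof (cases "\<omega> \<in> (\<Union>j. Bad j)")
      case False
      thus ?thesis using on_good[OF \<omega>, of lam] C0[of \<omega>] n1 unfolding G_def by (simp add: add_increasing2)
    next
      case True
      have "u2 \<omega> \<le> 4 * L\<^sup>2 + 6 * (E \<omega> / n)"
        using crude_bound[of \<sigma> f X L F "\<lambda>i. W i \<omega>", OF sigma_nonneg f_bounded[OF X_in_S]] lamhat_min[OF \<omega>]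
        unfolding u2_def response_def E_def n_def by simp
      also have "\<dots> \<le> 4 * L\<^sup>2 + (12 * \<sigma>\<^sup>2 + 6 * (exp (- (n / 4)) * C \<omega> / n))"
      proof (cases "E \<omega> / n \<le> 2 * \<sigma>\<^sup>2")
        case True
        moreover have "0 \<le> exp (- (n / 4)) * C \<omega> / n" using C0[of \<omega>] n1 by simp
        ultimately show ?thesis by linarith
      next
        case False
        \<comment> \<open>The cut at \<open>2 * \<sigma>\<^sup>2\<close> accounts for the constant
          \<open>12 * \<sigma>\<^sup>2\<close>; above it the exponent is nonnegative, so the weight
          is at least 1.\<close>
        hence "n / 4 \<le> E \<omega> / (8 * \<sigma>\<^sup>2)" using n1 s0 by (simp add: field_simps)
        hence "1 \<le> exp (E \<omega> / (8 * \<sigma>\<^sup>2) - n / 4)" by simp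
        hence "E \<omega> * 1 \<le> E \<omega> * exp (E \<omega> / (8 * \<sigma>\<^sup>2) - n / 4)"
          using E0 by (rule mult_left_mono)
        also have "\<dots> = exp (- (n / 4)) * C \<omega>"
          by (simp only: C_def diff_conv_add_uminus exp_add mult_ac)
        finally have "E \<omega> / n \<le> exp (- (n / 4)) * C \<omega> / n"
          using n1 by (simp add: divide_right_mono)
        thus ?thesis using zero_le_power2[of \<sigma>] by linarith
      qed
      finally show ?thesis using True B0[of lam] by (simp add: G_def)
    qed
    have G: "has_bochner_integral P G (B lam + (4 * L\<^sup>2 + 12 * \<sigma>\<^sup>2) * prob (\<Union>j. Bad j)
        + 6 / n * exp (- (n / 4)) * (n * (4 / 3 * \<sigma>\<^sup>2) * sqrt (4 / 3) ^ CARD('n)))"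
    proof -
      have "has_bochner_integral P (\<lambda>_. B lam) (B lam)"
        by (simp add: has_bochner_integral_iff prob_space)
      moreover have "has_bochner_integral P (indicator (\<Union>j. Bad j)) (prob (\<Union>j. Bad j))"
        by (rule has_bochner_integral_real_indicator) (auto simp: emeasure_eq_measure)
      ultimately show ?thesis
        unfolding G_def by (intro has_bochner_integral_add has_bochner_integral_mult_right C)
    qed
    hence G_int: "integrable P G" by (simp add: has_bochner_integral_iff)
    have int: "integrable P u2"
      using G_int
    proof (rule Bochner_Integration.integrable_bound)
      show "AE \<omega> in P. norm (u2 \<omega>) \<le> norm (G \<omega>)"
      proof (rule AE_I2)
        fix \<omega> assume "\<omega> \<in> space P"
        from le[OF this] u2_0[of \<omega>] show "norm (u2 \<omega>) \<le> norm (G \<omega>)" by simp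
      qed
    qed simp
    have "expectation u2 \<le> expectation G"
      using int G_int le by (rule integral_mono)
    also have "expectation G = B lam + (4 * L\<^sup>2 + 12 * \<sigma>\<^sup>2) * prob (\<Union>j. Bad j)
        + 6 * \<sigma>\<^sup>2 * (4 / 3 * (sqrt (4 / 3) ^ CARD('n) * exp (- (n / 4))))"
      using G n1 by (simp add: has_bochner_integral_iff)
    also have "\<dots> \<le> B lam + R1 + R2"
    proof -
      have "(4 * L\<^sup>2 + 12 * \<sigma>\<^sup>2) * prob (\<Union>j. Bad j) \<le> (4 * L\<^sup>2 + 12 * \<sigma>\<^sup>2) * (1 / (n * sqrt (pi * l)))"
        using Bad by (rule mult_left_mono) simp
      moreover have "6 * \<sigma>\<^sup>2 * (4 / 3 * (sqrt (4 / 3) ^ CARD('n) * exp (- (n / 4))))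
          \<le> 6 * \<sigma>\<^sup>2 * (sqrt ((n + 2) / n) * exp (- (n / 16)))"
        using exp_tail_constant[OF n1, of "CARD('n)"] by (intro mult_left_mono) (auto simp: n_def)
      ultimately show ?thesis by (simp add: R1_def R2_def mult.assoc)
    qed
    finally show ?thesis using int by blast
  qed
  \<comment> \<open>The remainders do not depend on \<open>lam\<close>; moved to the left they leave
    a common lower bound for the family, hence for its infimum.\<close>
  have "expectation u2 - R1 - R2 \<le> (INF lam :: real ^ 'm.
            (1 + \<epsilon>) * (emp_norm X (\<lambda>x. lin_comb F lam x - f x))\<^sup>2
            + 8 * (4 + \<epsilon> + 4 / \<epsilon>) * (\<sigma>\<^sup>2 / \<kappa>) * (l / n) * real (num_nonzero lam))"
    using risk Bt by (intro cINF_greatest) (simp, smt (verit))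
  thus ?thesis
    using risk unfolding u2_def R1_def R2_def l_def m_def n_def by (simp add: algebra_simps)
qed

end
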